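(* Let $n\ge 1$ and let $Z$ be a double helix of order $n$ whose initial string $\tau$ of length $n$ is neither the all-zero nor the all-one string. Let $Y$ be the initial string of length $2^n-1$ of either $EM_n(Z)$ or $EM(Z)$. Then the path in ${\cal B}^n$ induced by $\tau_-Y$ is the message loop of $Z$ (i.e. it is a closed path traversing each edge of the message loop exactly once), and $ZY$ is a depleted DeBruijn string of order $n+1$.
   Context: All strings are over the alphabet $\{0,1\}$; for a digit $y$, $y' = 1-y$; $\tau_-$ denotes $\tau$ with its last digit removed. A DeBruijn string of order $m$ is a binary string of length $2^m+m-1$ that contains every binary string of length $m$ as a (contiguous) substring. A depleted DeBruijn string of order $m$ is a binary string that contains every string of length $m$ exactly once, except that one or both of the all-zero and all-one strings of length $m$ do not occur in it. The DeBruijn graph ${\cal B}^n$ is the directed graph whose vertices are the binary strings of length $n$, with an edge from $x\rho$ (with $x$ a digit, $|\rho|=n-1$) to each of $\rho0$ and $\rho1$, and no other edges. A binary string of length at least $n$ induces a path in ${\cal B}^n$ visiting in order its successive substrings of length $n$. A DeBruijn string $X$ of order $n$ begins and ends with the same string of length $n-1$, so its induced path visits every vertex once and closes up, by the edge from its last vertex to its first, to a Hamiltonian circuit of ${\cal B}^n$. $X$ is a double helix (of order $n$) if the graph obtained from ${\cal B}^n$ by removing the edges of this circuit has exactly 3 connected components; two of these are the loops at the all-zero and all-one strings, and the remaining one is a directed cycle, called the message loop of $X$. Definition of $EM(Z)$ and $EM_n(Z)$ for $n\ge1$ and a nonempty finite binary string $Z$: each is an infinite binary sequence $x_1x_2x_3\dots$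 generated digit by digit as follows. Suppose $x_1,\dots,x_k$ ($k\ge 0$) have been generated and let $W = Zx_1\cdots x_k$. Let $\sigma$ be the longest tail (suffix, possibly empty) of $W$ — for $EM_n(Z)$, the longest one among those with $|\sigma|\le n$; for $EM(Z)$, with no length restriction — that also occurs as a substring of $W$ with its last digit removed. Take the latest (rightmost) such earlier occurrence and let $y$ be the digit of $W$ immediately following it; if $\sigma$ is empty, $y$ is the last digit of $W$. Then $x_{k+1} = y'$. The sequences do not include the seed $Z$. *)

theory Defs
  imports
    "HOL-Library.Sublist"
    "HOL-Library.Extended_Nat"
    "Graph_Theory.Graph_Theory"
begin

(* Binary strings are lists over bool, with False for the digit 0 and True for the digit 1;
   the complementary digit of y is (\<not> y). *)

definition occurs_at :: "'a list \<Rightarrow> nat \<Rightarrow> 'a list \<Rightarrow> bool" where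
  "occurs_at \<sigma> i W \<longleftrightarrow> i + length \<sigma> \<le> length W \<and> take (length \<sigma>) (drop i W) = \<sigma>"

definition debruijn_string :: "nat \<Rightarrow> bool list \<Rightarrow> bool" where
  "debruijn_string m X \<longleftrightarrow>
     length X = 2 ^ m + m - 1 \<and> (\<forall>w. length w = m \<longrightarrow> sublist w X)"

(* D is the set of omitted strings: one or both of the two constant strings. *)
definition depleted_debruijn_string :: "nat \<Rightarrow> bool list \<Rightarrow> bool" where
  "depleted_debruijn_string m X \<longleftrightarrow>
     (\<exists>D. D \<noteq> {} \<and> D \<subseteq> {replicate m False, replicate m True} \<and>
          (\<forall>w. length w = m \<longrightarrow> card {i. occurs_at w i X} = (if w \<in> D then 0 else 1)))"

(* B^n has no parallel edges, so an edge is the pair of its end vertices. *)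
definition debruijn_graph :: "nat \<Rightarrow> bool list pair_pre_digraph" where
  "debruijn_graph n =
     \<lparr>pverts = {v. length v = n},
      parcs = {(x # \<rho>, \<rho> @ [y]) | x \<rho> y. Suc (length \<rho>) = n}\<rparr>"

(* Meaningful for length s \<ge> n. *)
definition path_verts :: "nat \<Rightarrow> 'a list \<Rightarrow> 'a list list" where
  "path_verts n s = map (\<lambda>i. take n (drop i s)) [0..<Suc (length s - n)]"

definition induced_path :: "nat \<Rightarrow> 'a list \<Rightarrow> ('a list \<times> 'a list) awalk" where
  "induced_path n s = vwalk_arcs (path_verts n s)"

definition circuit_arcs :: "nat \<Rightarrow> bool list \<Rightarrow> (bool list \<times> bool list) set" where
  "circuit_arcs n X =
     insert (last (path_verts n X), hd (path_verts n X)) (set (induced_path n X))"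

definition circuit_complement ::
    "nat \<Rightarrow> bool list \<Rightarrow> (bool list, bool list \<times> bool list) pre_digraph" where
  "circuit_complement n X =
     with_proj (debruijn_graph n\<lparr>parcs := parcs (debruijn_graph n) - circuit_arcs n X\<rparr>)"

(* The predicate connected of Digraph_Component refers to the underlying undirected graph,
   so these are the weakly connected components. *)
definition components :: "('a, 'b) pre_digraph \<Rightarrow> ('a, 'b) pre_digraph set" where
  "components G = {H. pre_digraph.max_subgraph G connected H}"

definition double_helix :: "nat \<Rightarrow> bool list \<Rightarrow> bool" where
  "double_helix n X \<longleftrightarrow>
     debruijn_string n X \<and> card (components (circuit_complement n X)) = 3"

definition loop_graph :: "'a \<Rightarrow> ('a, 'a \<times> 'a) pre_digraph" where
  "loop_graph v = with_proj \<lparr>pverts = {v}, parcs = {(v, v)}\<rparr>"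

definition message_loop ::
    "nat \<Rightarrow> bool list \<Rightarrow> (bool list, bool list \<times> bool list) pre_digraph" where
  "message_loop n X =
     (THE L. L \<in> components (circuit_complement n X) \<and>
             L \<noteq> loop_graph (replicate n False) \<and> L \<noteq> loop_graph (replicate n True))"

(* The bound b on the length of the tail is an enat, so that EM_n and EM are the cases
   b = enat n and b = \<infinity> of one construction. *)
definition repeated_tail :: "enat \<Rightarrow> bool list \<Rightarrow> bool list" where
  "repeated_tail b W =
     (ARG_MAX length \<sigma>. suffix \<sigma> W \<and> enat (length \<sigma>) \<le> b \<and> sublist \<sigma> (butlast W))"

definition em_next :: "enat \<Rightarrow> bool list \<Rightarrow> bool" where
  "em_next b W =
     (let \<sigma> = repeated_tail b W;
          y = (if \<sigma> = [] then last W
               else W ! (Max {i. occurs_at \<sigma> i (butlast W)} + length \<sigma>))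
      in \<not> y)"

primrec em_word :: "enat \<Rightarrow> bool list \<Rightarrow> nat \<Rightarrow> bool list" where
  "em_word b Z 0 = Z"
| "em_word b Z (Suc k) = em_word b Z k @ [em_next b (em_word b Z k)]"

(* Sequences are indexed from 0: position k holds the digit x_(k+1), and em_word b Z k is
   Z x_1 ... x_k. *)
definition em_seq :: "enat \<Rightarrow> bool list \<Rightarrow> nat \<Rightarrow> bool" where
  "em_seq b Z k = em_next b (em_word b Z k)"

definition EM_n :: "nat \<Rightarrow> bool list \<Rightarrow> nat \<Rightarrow> bool" where
  "EM_n n Z = em_seq (enat n) Z"

definition EM :: "bool list \<Rightarrow> nat \<Rightarrow> bool" where
  "EM Z = em_seq \<infinity> Z"

definition initial_string :: "nat \<Rightarrow> (nat \<Rightarrow> 'a) \<Rightarrow> 'a list" where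
  "initial_string k x = map x [0..<k]"

end

(* Because Z contains every word of length n once, each vertex v has one circuit successor, and its
   other successor is obtained by flipping the last digit; this gives a permutation of the vertices
   whose cycles are the weak components of the circuit complement.  The first digit produced by
   either construction closes the circuit and brings the path back to tau.  From then on the longest
   repeated tail is exactly the current vertex v, because the edge just traversed is new; as long as
   v is new on the loop, its latest earlier occurrence is the one in Z, so the rule picks
   the edge out of v that Z did not use.  The path thus runs once around the cycle of tau, which
   by the count of components is everything except the two constant words. *)
theory Submission
  imports Defs "HOL-Combinatorics.Orbits"
begin

section \<open>Permutation graphs and their components\<close>

text \<open>Arcs are pairs of end vertices, as in \<open>loop_graph\<close> and
  \<open>circuit_complement\<close>, so that both become equal to graphs of this form and not merely
  isomorphic to them.\<close>

definition perm_graph :: "('a \<Rightarrow> 'a) \<Rightarrow> 'a set \<Rightarrow> ('a, 'a \<times> 'a) pre_digraph" where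
  "perm_graph f S = with_proj \<lparr>pverts = S, parcs = (\<lambda>u. (u, f u)) ` S\<rparr>"

lemma perm_graph_simps [simp]:
  "verts (perm_graph f S) = S" "arcs (perm_graph f S) = (\<lambda>u. (u, f u)) ` S"
  "tail (perm_graph f S) = fst" "head (perm_graph f S) = snd"
  by (simp_all add: perm_graph_def)

lemma perm_graph_fixpoint: "f a = a \<Longrightarrow> perm_graph f {a} = loop_graph a"
  by (simp add: perm_graph_def loop_graph_def)

lemma wf_perm_graph: "f ` S \<subseteq> S \<Longrightarrow> wf_digraph (perm_graph f S)"
  by unfold_locales auto

text \<open>Iterating \<open>f\<close> leads from any point of a cycle to any other, so directed
  reachability already gives connectedness of the symmetrised graph.\<close>

lemma connected_perm_graph_orbit:
  assumes "permutation f"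
  shows "connected (perm_graph f (orbit f x))"
proof -
  let ?O = "orbit f x"
  let ?M = "mk_symmetric (perm_graph f ?O)"
  have cyc: "cyclic_on f ?O"
    using assms by (rule cyclic_on_orbit')
  have arc: "(u, f u) \<in> parcs ?M" if "u \<in> ?O" for u
    using that by (auto simp: mk_symmetric_def)
  have pverts: "pverts ?M = ?O"
    by (simp add: mk_symmetric_def)
  have "(u, v) \<in> rtrancl_on ?O (parcs ?M)" if u: "u \<in> ?O" and v: "v \<in> ?O" for u v
  proof -
    have "v \<in> orbit f u"
      using orbit_cyclic_eq3[OF cyc u] v by (simp only:)
    then show ?thesis
    proof induction
      case base
      show ?case
        by (rule rtrancl_on_into_rtrancl_on[OF rtrancl_on_refl[OF u] arc[OF u] cyclic_on_inI[OF cyc u]])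
    next
      case (step v)
      have v: "v \<in> ?O"
        using step.hyps orbit_cyclic_eq3[OF cyc u] by (simp only:)
      show ?case
        by (rule rtrancl_on_into_rtrancl_on[OF step.IH arc[OF v] cyclic_on_inI[OF cyc v]])
    qed
  qed
  then show ?thesis
    unfolding connected_def using orbit_nonempty[of f x]
    by (intro strongly_connectedI) (auto simp: pverts reachable_def)
qed

text \<open>Each arc joins some \<open>u\<close> to \<open>f u\<close>, and an orbit of a
  permutation is closed under images and preimages, so a connected subgraph containing the orbit
  gains no vertex. It gains no arc either, as an arc is determined by its tail.\<close>

lemma orbit_component:
  assumes f: "f permutes V" "finite V" and x: "x \<in> V"
  shows "perm_graph f (orbit f x) \<in> components (perm_graph f V)"
proof -
  let ?O = "orbit f x"
  let ?G = "perm_graph f V" and ?C = "perm_graph f ?O"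
  have perm: "permutation f"
    using f permutation_permutes by blast
  have cyc: "cyclic_on f ?O"
    using perm by (rule cyclic_on_orbit')
  have sub: "?O \<subseteq> V"
    using permutes_orbit_subset[OF f(1) x] .
  have wfG: "wf_digraph ?G"
    using permutes_in_image[OF f(1)] by (intro wf_perm_graph) auto
  have CG: "subgraph ?C ?G"
    using sub wfG cyclic_on_inI[OF cyc]
    by (auto simp: subgraph_def compatible_def intro!: wf_perm_graph)
  have "H = ?C" if "subgraph ?C H" "subgraph H ?G" "connected H" for H
  proof -
    have tl: "tail H = fst" "head H = snd" and arcsH: "arcs H \<subseteq> arcs ?G" "arcs ?C \<subseteq> arcs H"
      and vertsH: "?O \<subseteq> verts H" and wf: "wf_digraph H"
      using that by (auto simp: subgraph_def compatible_def)
    have step: "v \<in> ?O" if "(u, v) \<in> parcs (mk_symmetric H)" "u \<in> ?O" for u v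
    proof -
      obtain e where "e \<in> arcs H" "(u, v) = (fst e, snd e) \<or> (u, v) = (snd e, fst e)"
        using \<open>(u, v) \<in> _\<close> by (auto simp: mk_symmetric_def tl)
      then have "v = f u \<or> u = f v"
        using arcsH by auto
      then show ?thesis
        using that(2) cyclic_on_inI[OF cyc] cyclic_on_f_in[OF f(1) cyc] by blast
    qed
    have "v \<in> ?O" if v: "v \<in> verts H" for v
    proof -
      have "x \<in> ?O"
        using perm by (rule permutation_self_in_orbit)
      then have "x \<rightarrow>\<^sup>*\<^bsub>with_proj (mk_symmetric H)\<^esub> v"
        using \<open>connected H\<close> v vertsH
        by (auto simp: connected_def strongly_connected_def mk_symmetric_def)
      then have "(x, v) \<in> (parcs (mk_symmetric H))\<^sup>*"
        by (auto simp: reachable_def dest: rtrancl_on_rtranclI)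
      then show ?thesis
        by induction (use \<open>x \<in> ?O\<close> step in auto)
    qed
    with vertsH have V: "verts H = ?O"
      by auto
    have "e \<in> arcs ?C" if e: "e \<in> arcs H" for e
    proof -
      obtain u where "e = (u, f u)"
        using arcsH(1) e by auto
      then show ?thesis
        using wf_digraph.tail_in_verts[OF wf e] tl V by simp
    qed
    with arcsH(2) have "arcs H = arcs ?C"
      by blast
    with V tl show ?thesis
      by (intro pre_digraph.equality) auto
  qed
  with CG connected_perm_graph_orbit[OF perm] show ?thesis
    unfolding components_def pre_digraph.max_subgraph_def by blast
qed

text \<open>The two fixed points and the orbit of \<open>x\<close> give three different components.
  The count leaves room for no more, so every remaining vertex lies in that orbit.\<close>

lemma three_components:
  assumes f: "f permutes V" "finite V" and card: "card (components (perm_graph f V)) = 3"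
    and ab: "a \<in> V" "b \<in> V" "f a = a" "f b = b" "a \<noteq> b" and x: "x \<in> V" "x \<noteq> a" "x \<noteq> b"
  shows "orbit f x = V - {a, b}"
    and "(THE L. L \<in> components (perm_graph f V) \<and> L \<noteq> loop_graph a \<and> L \<noteq> loop_graph b)
           = perm_graph f (orbit f x)"
proof -
  let ?K = "components (perm_graph f V)" and ?C = "\<lambda>u. perm_graph f (orbit f u)"
  have perm: "permutation f"
    using f permutation_permutes by blast
  have self: "u \<in> orbit f u" for u
    using perm by (rule permutation_self_in_orbit)
  have ob: "orbit f a = {a}" "orbit f b = {b}"
    using ab by (simp_all only: orbit_eq_singleton_iff)
  have x': "a \<notin> orbit f x" "b \<notin> orbit f x"
    using orbit_swap[OF self, of a x] orbit_swap[OF self, of b x] ob x by auto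
  have inj: "orbit f u = orbit f v" if "?C u = ?C v" for u v
    using that by (metis perm_graph_simps(1))
  have ne: "?C a \<noteq> ?C b" "?C x \<noteq> ?C a" "?C x \<noteq> ?C b"
    using inj[of a b] inj[of x a] inj[of x b] ab x' ob self[of x] by auto
  then have "card {?C a, ?C b, ?C x} = 3"
    by auto
  moreover have "{?C a, ?C b, ?C x} \<subseteq> ?K"
    using orbit_component[OF f] ab x by blast
  \<comment> \<open>\<open>card\<close> of an infinite set is 0, so the value 3 forces
    finiteness.\<close>
  moreover have "finite ?K"
    using card card.infinite by fastforce
  ultimately have K: "?K = {?C a, ?C b, ?C x}"
    using card by (metis card_subset_eq)
  have "u \<in> orbit f x" if "u \<in> V" "u \<noteq> a" "u \<noteq> b" for u
  proof -
    have "?C u = ?C a \<or> ?C u = ?C b \<or> ?C u = ?C x"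
      using orbit_component[OF f that(1)] unfolding K by simp
    then have "orbit f u = {a} \<or> orbit f u = {b} \<or> orbit f u = orbit f x"
      using inj ob by metis
    then show ?thesis
      using self[of u] that by auto
  qed
  then show "orbit f x = V - {a, b}"
    using x' permutes_orbit_subset[OF f(1) x(1)] by auto
  have "loop_graph a = ?C a" "loop_graph b = ?C b"
    using perm_graph_fixpoint[of f] ab ob by simp_all
  with K ne show "(THE L. L \<in> ?K \<and> L \<noteq> loop_graph a \<and> L \<noteq> loop_graph b) = ?C x"
    by (intro the_equality) auto
qed

section \<open>Walks along an orbit\<close>

lemma vwalk_arcs_map_upt:
  "vwalk_arcs (map g [0..<Suc k]) = map (\<lambda>j. (g j, g (Suc j))) [0..<k]"
proof (induction k)
  case (Suc k)
  have "vwalk_arcs (map g [0..<Suc k] @ [g (Suc k)])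
      = vwalk_arcs (map g [0..<Suc k]) @ [(g k, g (Suc k))]"
    by (subst vwalk_arcs_append) simp_all
  with Suc show ?case
    by simp
qed simp

lemma pcas_append: "pcas u (p @ q) v \<longleftrightarrow> (\<exists>w. pcas u p w \<and> pcas w q v)"
  by (induction p arbitrary: u) auto

lemma pcas_map_upt: "pcas (g 0) (map (\<lambda>j. (g j, g (Suc j))) [0..<k]) (g k)"
  by (induction k) (auto simp: pcas_append)

lemma set_pawalk_verts: "set (pawalk_verts u p) \<subseteq> insert u (fst ` set p \<union> snd ` set p)"
  by (induction p arbitrary: u) auto

lemma fst_in_pawalk_verts: "fst ` set p \<subseteq> set (pawalk_verts u p)"
  by (induction p arbitrary: u) auto

text \<open>\<open>p\<close> is the first positive return time of \<open>x\<close>. The iterates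
  before it list the orbit without repetition, so their outgoing arcs are distinct and are all the
  arcs of the cycle.\<close>

lemma euler_trail_orbit:
  fixes f :: "'a \<Rightarrow> 'a" and x :: 'a
  assumes "permutation f"
  defines "p \<equiv> funpow_dist1 f x x"
  shows "pre_digraph.euler_trail (perm_graph f (orbit f x)) x
           (vwalk_arcs (map (\<lambda>j. (f ^^ j) x) [0..<Suc p])) x"
proof -
  have self: "x \<in> orbit f x"
    using assms(1) by (rule permutation_self_in_orbit)
  let ?p = "map (\<lambda>j. ((f ^^ j) x, (f ^^ Suc j) x)) [0..<p]"
  have p: "vwalk_arcs (map (\<lambda>j. (f ^^ j) x) [0..<Suc p]) = ?p"
    using vwalk_arcs_map_upt[of "\<lambda>j. (f ^^ j) x" p] by simp
  have "pcas x ?p ((f ^^ p) x)"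
    using pcas_map_upt[of "\<lambda>j. (f ^^ j) x" p] by simp
  moreover have "(f ^^ p) x = x"
    unfolding p_def using self by (rule funpow_dist1_prop)
  ultimately have cas: "pcas x ?p x"
    by (simp only:)
  have orb: "orbit f x = (\<lambda>j. (f ^^ j) x) ` {0..<p}"
    unfolding p_def using self by (rule orbit_conv_funpow_dist1)
  then have arcs: "set ?p = (\<lambda>u. (u, f u)) ` orbit f x"
    by (simp add: image_image)
  have dist: "distinct ?p"
    using inj_on_funpow_dist1[OF self, folded p_def]
    by (simp add: distinct_map inj_on_def)
  have "set (pawalk_verts x ?p) = orbit f x"
  proof
    show "set (pawalk_verts x ?p) \<subseteq> orbit f x"
    proof -
      have "insert x (fst ` set ?p \<union> snd ` set ?p) \<subseteq> orbit f x"
        unfolding arcs using self by (auto intro: orbit.step)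
      then show ?thesis
        using set_pawalk_verts[of x ?p] by (rule subset_trans[rotated])
    qed
    show "orbit f x \<subseteq> set (pawalk_verts x ?p)"
      using fst_in_pawalk_verts[of ?p x] unfolding arcs by force
  qed
  then show ?thesis
    unfolding p pre_digraph.euler_trail_def pre_digraph.trail_def pre_digraph.awalk_def
    using self cas arcs dist
    by (simp add: perm_graph_def cas_with_proj_eq awalk_verts_with_proj_eq del: upt_Suc)
qed

section \<open>Windows of a sequence and the digit rule\<close>

text \<open>Taken from an infinite sequence, so that seed and generated digits can be compared by
  position however much has been generated.\<close>

definition window :: "(nat \<Rightarrow> 'a) \<Rightarrow> nat \<Rightarrow> nat \<Rightarrow> 'a list" where
  "window w m i = map w [i..<i + m]"

lemma length_window [simp]: "length (window w m i) = m"
  by (simp add: window_def)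

lemma window_eq_iff: "window w m i = window w m j \<longleftrightarrow> (\<forall>k<m. w (i + k) = w (j + k))"
  by (simp add: window_def list_eq_iff_nth_eq)

lemma window_Suc: "window w (Suc m) i = w i # window w m (Suc i)"
  unfolding window_def by (simp add: upt_conv_Cons del: upt_Suc)

lemma window_Suc_append: "window w (Suc m) i = window w m i @ [w (i + m)]"
  by (simp add: window_def)

lemma window_Suc_tl: "window w (Suc m) (Suc i) = tl (window w (Suc m) i) @ [w (i + Suc m)]"
  by (simp add: window_Suc[of w m i] window_Suc_append[of w m "Suc i"])

lemma take_drop_window:
  "i + m \<le> L \<Longrightarrow> take m (drop i (window w L a)) = window w m (a + i)"
  by (simp add: window_def drop_map take_map add.assoc)

lemma take_drop_eq_window:
  "i + m \<le> L \<Longrightarrow> take m (drop i (map w [0..<L])) = window w m i"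
  using take_drop_window[of i m L w 0] by (simp add: window_def)

lemma occurs_at_map_upt:
  "occurs_at \<sigma> i (map w [0..<L]) \<longleftrightarrow> i + length \<sigma> \<le> L \<and> window w (length \<sigma>) i = \<sigma>"
  using take_drop_eq_window[of i "length \<sigma>" L w] by (auto simp: occurs_at_def)

lemma sublist_iff_occurs_at: "sublist \<sigma> W \<longleftrightarrow> (\<exists>i. occurs_at \<sigma> i W)"
proof
  assume "sublist \<sigma> W"
  then obtain ps ss where "W = ps @ \<sigma> @ ss"
    by (auto simp: sublist_def)
  then have "occurs_at \<sigma> (length ps) W"
    by (simp add: occurs_at_def)
  then show "\<exists>i. occurs_at \<sigma> i W" ..
next
  assume "\<exists>i. occurs_at \<sigma> i W"
  then obtain i where "take (length \<sigma>) (drop i W) = \<sigma>"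
    by (auto simp: occurs_at_def)
  then show "sublist \<sigma> W"
    by (metis sublist_drop sublist_order.order_trans sublist_take)
qed

lemma suffix_map_upt:
  "suffix \<sigma> (map w [0..<L]) \<longleftrightarrow> length \<sigma> \<le> L \<and> \<sigma> = window w (length \<sigma>) (L - length \<sigma>)"
proof -
  have "suffix \<sigma> W \<longleftrightarrow> length \<sigma> \<le> length W \<and> \<sigma> = drop (length W - length \<sigma>) W" for W
  proof
    assume "suffix \<sigma> W"
    then obtain zs where "W = zs @ \<sigma>"
      by (auto simp: suffix_def)
    then show "length \<sigma> \<le> length W \<and> \<sigma> = drop (length W - length \<sigma>) W"
      by simp
  next
    assume "length \<sigma> \<le> length W \<and> \<sigma> = drop (length W - length \<sigma>) W"
    then show "suffix \<sigma> W"
      using suffix_drop[of "length W - length \<sigma>" W] by simp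
  qed
  then show ?thesis
    by (auto simp: window_def drop_map)
qed

text \<open>Dropping first digits from a tail that occurs earlier leaves another such tail, so
  refuting length \<open>Suc m\<close> (\<open>longest\<close>) refutes every greater length. The
  strict bounds place the occurrences inside \<open>butlast\<close>, so that a digit follows
  them.\<close>

lemma em_next_eq:
  assumes m: "0 < m" "enat m \<le> b" and i: "i + m < L"
    and eq: "window w m i = window w m (L - m)"
    and latest: "\<And>j. i < j \<Longrightarrow> j + m < L \<Longrightarrow> window w m j \<noteq> window w m (L - m)"
    and longest: "\<And>j. j + Suc m < L \<Longrightarrow> window w (Suc m) j \<noteq> window w (Suc m) (L - Suc m)"
  shows "em_next b (map w [0..<L]) = (\<not> w (i + m))"
proof -
  let ?W = "map w [0..<L]" and ?t = "window w m (L - m)"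
  let ?P = "\<lambda>\<sigma>. suffix \<sigma> ?W \<and> enat (length \<sigma>) \<le> b \<and> sublist \<sigma> (butlast ?W)"
  have bl: "butlast ?W = map w [0..<L - 1]"
    by (cases L) simp_all
  have occ: "occurs_at ?t j (butlast ?W) \<longleftrightarrow> j + m < L \<and> window w m j = ?t" for j
    using i by (auto simp: bl occurs_at_map_upt)
  have P: "?P ?t"
    using m i eq occ by (auto simp: suffix_map_upt sublist_iff_occurs_at)
  have max: "length \<sigma> \<le> m" if "?P \<sigma>" for \<sigma>
  proof (rule ccontr)
    assume "\<not> length \<sigma> \<le> m"
    then obtain d where d: "length \<sigma> = d + Suc m"
      by (metis add.commute add_Suc_right less_imp_Suc_add not_le)
    from that obtain j where "occurs_at \<sigma> j (map w [0..<L - 1])" and "suffix \<sigma> ?W"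
      using bl by (auto simp: sublist_iff_occurs_at)
    then have "j + length \<sigma> < L" "window w (length \<sigma>) j = \<sigma>"
      and "\<sigma> = window w (length \<sigma>) (L - length \<sigma>)"
      using i unfolding occurs_at_map_upt suffix_map_upt by linarith+
    then have j: "j + d + Suc m < L" and "window w (d + Suc m) j = window w (d + Suc m) (L - (d + Suc m))"
      using d by auto
    then have "w (j + k) = w (L - (d + Suc m) + k)" if "k < d + Suc m" for k
      using that by (simp add: window_eq_iff)
    \<comment> \<open>Dropping the first \<open>d\<close> digits of the too long repeat leaves one
      of length \<open>Suc m\<close>.\<close>
    from this[of "d + _"] have "window w (Suc m) (j + d) = window w (Suc m) (L - (d + Suc m) + d)"
      by (simp add: window_eq_iff add.assoc)
    also have "L - (d + Suc m) + d = L - Suc m"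
      using j by simp
    finally show False
      using longest j by blast
  qed
  let ?r = "repeated_tail b ?W"
  have "?P ?r \<and> (\<forall>\<sigma>. ?P \<sigma> \<longrightarrow> length \<sigma> \<le> length ?r)"
    unfolding repeated_tail_def using P max
    by (intro arg_max_nat_lemma[where b = "Suc m"]) (auto simp: less_Suc_eq_le)
  then have "length ?r = m" "suffix ?r ?W"
    using P max by (auto intro!: antisym)
  then have r: "?r = ?t"
    by (simp add: suffix_map_upt)
  have "Max {j. occurs_at ?t j (butlast ?W)} = i"
  proof (rule Max_eqI)
    show "finite {j. occurs_at ?t j (butlast ?W)}"
      by (rule finite_subset[of _ "{..<L}"]) (auto simp: occ)
    show "i \<in> {j. occurs_at ?t j (butlast ?W)}"
      using i eq by (simp add: occ)
    show "j \<le> i" if "j \<in> {j. occurs_at ?t j (butlast ?W)}" for j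
      using that latest by (auto simp: occ not_le[symmetric])
  qed
  moreover have "?t \<noteq> []"
    using m by (metis length_window less_irrefl list.size(3))
  ultimately show ?thesis
    using i by (simp add: em_next_def Let_def r)
qed

lemma em_word_eq_map:
  "em_word b Z k = map (\<lambda>i. if i < length Z then Z ! i else em_seq b Z (i - length Z)) [0..<length Z + k]"
proof (induction k)
  case 0
  show ?case
    by (rule nth_equalityI) simp_all
next
  case (Suc k)
  have "em_word b Z (Suc k) = em_word b Z k @ [em_seq b Z k]"
    by (simp add: em_seq_def)
  with Suc show ?case
    by simp
qed

section \<open>The circuit of a de Bruijn string\<close>

lemma finite_binary_words: "finite {v :: bool list. length v = n}"
  and card_binary_words: "card {v :: bool list. length v = n} = 2 ^ n"
  using finite_lists_length_eq[of "UNIV :: bool set" n] card_lists_length_eq[of "UNIV :: bool set" n]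
  by simp_all

text \<open>A string of this length has only as many windows as there are words, so covering all
  words forces the windows to be distinct.\<close>

lemma debruijn_windows:
  assumes "debruijn_string (Suc m) (map w [0..<2 ^ Suc m + m])"
  shows "bij_betw (window w (Suc m)) {..<2 ^ Suc m} {v. length v = Suc m}"
proof -
  have "{v. length v = Suc m} \<subseteq> window w (Suc m) ` {..<2 ^ Suc m}"
  proof
    fix v :: "bool list"
    assume v: "v \<in> {v. length v = Suc m}"
    then obtain i where "occurs_at v i (map w [0..<2 ^ Suc m + m])"
      using assms by (auto simp: debruijn_string_def sublist_iff_occurs_at)
    then have "i + Suc m \<le> 2 ^ Suc m + m" "window w (Suc m) i = v"
      using v by (simp_all only: occurs_at_map_upt mem_Collect_eq)
    then show "v \<in> window w (Suc m) ` {..<2 ^ Suc m}"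
      by (intro image_eqI[of _ _ i]) auto
  qed
  then have img: "window w (Suc m) ` {..<2 ^ Suc m} = {v. length v = Suc m}"
    by auto
  then have "inj_on (window w (Suc m)) {..<2 ^ Suc m}"
    by (intro eq_card_imp_inj_on) (simp_all only: card_binary_words card_lessThan finite_lessThan)
  with img show ?thesis
    by (simp add: bij_betw_def)
qed

text \<open>Every word of length \<^term>\<open>m\<close> has exactly two occurrences as the head, and exactly two as the
  tail, of a window of length \<^term>\<open>Suc m\<close>; only the two extreme positions can break this balance.\<close>

lemma debruijn_ends:
  fixes w :: "nat \<Rightarrow> bool"
  assumes bij: "bij_betw (window w (Suc m)) {..<2 ^ Suc m} {v. length v = Suc m}"
  shows "window w m (2 ^ Suc m) = window w m 0"
proof (rule ccontr)
  let ?N = "2 ^ Suc m :: nat" and ?u = "window w m 0"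
  assume ne: "window w m ?N \<noteq> ?u"
  \<comment> \<open>Taken with \<open>butlast\<close> and with \<open>tl\<close>, this reduces
    counting the windows that begin or end with \<open>?u\<close> to counting words.\<close>
  have fiber: "card {i \<in> {..<?N}. g (window w (Suc m) i) = ?u} = card {v \<in> {v. length v = Suc m}. g v = ?u}"
    for g
  proof (rule bij_betw_same_card, rule bij_betw_subset[OF bij])
    show "window w (Suc m) ` {i \<in> {..<?N}. g (window w (Suc m) i) = ?u} = {v \<in> {v. length v = Suc m}. g v = ?u}"
      unfolding bij_betw_imp_surj_on[OF bij, symmetric] by blast
  qed auto
  have "{v :: bool list \<in> {v. length v = Suc m}. butlast v = ?u} = {?u @ [False], ?u @ [True]}"
  proof (intro set_eqI iffI)
    fix v :: "bool list" assume "v \<in> {v \<in> {v. length v = Suc m}. butlast v = ?u}"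
    then show "v \<in> {?u @ [False], ?u @ [True]}"
      by (cases v rule: rev_cases) auto
  qed auto
  then have A: "card {i \<in> {..<?N}. window w m i = ?u} = 2"
    using fiber[of butlast] by (simp add: window_Suc_append)
  have "{v :: bool list \<in> {v. length v = Suc m}. tl v = ?u} = {False # ?u, True # ?u}"
  proof (intro set_eqI iffI)
    fix v :: "bool list" assume "v \<in> {v \<in> {v. length v = Suc m}. tl v = ?u}"
    then show "v \<in> {False # ?u, True # ?u}"
      by (cases v) auto
  qed auto
  then have "card {i \<in> {..<?N}. window w m (Suc i) = ?u} = 2"
    using fiber[of tl] by (simp add: window_Suc)
  then have B: "card (Suc ` {i \<in> {..<?N}. window w m (Suc i) = ?u}) = 2"
    by (simp add: card_image)
  \<comment> \<open>A window at \<open>i\<close> ending in \<open>?u\<close> puts \<open>?u\<close>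
    at \<open>Suc i\<close>, which is not 0 and is below \<open>?N\<close> by \<open>ne\<close>. So
    two such windows would need two occurrences of \<open>?u\<close> as a head away from 0, where
    there is only one.\<close>
  have "Suc ` {i \<in> {..<?N}. window w m (Suc i) = ?u} \<subseteq> {i \<in> {..<?N}. window w m i = ?u} - {0}"
    using ne by (auto intro: Suc_lessI)
  from card_mono[OF _ this] have "card (Suc ` {i \<in> {..<?N}. window w m (Suc i) = ?u})
      \<le> card ({i \<in> {..<?N}. window w m i = ?u} - {0})"
    by simp
  also have "\<dots> = 1"
    using A by (subst card_Diff_singleton) auto
  finally show False
    using B by simp
qed

text \<open>The last \<open>m\<close> digits of the seed form its initial word \<open>u\<close>,
  which begins just two windows, at 0 and at a later \<open>i\<close>, followed by opposite digits.
  Complementing the digit after the later one gives the digit after the first. No longer tail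
  recurs, since the last window occurs once.\<close>

lemma em_closes_debruijn:
  fixes w :: "nat \<Rightarrow> bool"
  assumes bij: "bij_betw (window w (Suc m)) {..<2 ^ Suc m} {v. length v = Suc m}"
    and m: "0 < m" "enat m \<le> b"
    and em: "w (2 ^ Suc m + m) = em_next b (map w [0..<2 ^ Suc m + m])"
  shows "window w (Suc m) (2 ^ Suc m) = window w (Suc m) 0"
proof -
  define N where "N = (2 ^ Suc m :: nat)"
  define u where "u = window w m 0"
  have inj: "i = j" if "window w (Suc m) i = window w (Suc m) j" "i < N" "j < N" for i j
    using that bij unfolding N_def by (auto simp: bij_betw_def inj_on_def)
  have "0 < N"
    by (simp add: N_def)
  have ends: "window w m N = u"
    using debruijn_ends[OF bij] by (simp add: N_def u_def)
  \<comment> \<open>The window at 0 is \<open>u @ [w m]\<close>; the other extension of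
    \<open>u\<close> locates its second occurrence.\<close>
  have "u @ [\<not> w m] \<in> window w (Suc m) ` {..<N}"
    using bij unfolding N_def bij_betw_def by (simp add: u_def)
  then obtain i where i: "i < N" "window w (Suc m) i = u @ [\<not> w m]"
    by auto
  have ui: "window w m i = u" "w (i + m) = (\<not> w m)"
    using i(2) by (simp_all add: window_Suc_append)
  have "em_next b (map w [0..<N + m]) = (\<not> w (i + m))"
  proof (rule em_next_eq[OF m])
    show "i + m < N + m" "window w m i = window w m (N + m - m)"
      using i ui ends by simp_all
  next
    fix j
    assume j: "i < j" "j + m < N + m"
    show "window w m j \<noteq> window w m (N + m - m)"
    proof
      assume "window w m j = window w m (N + m - m)"
      then have "window w m j = u"
        using ends by simp
      then have "window w (Suc m) j = window w (Suc m) 0 \<or> window w (Suc m) j = window w (Suc m) i"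
        using ui by (auto simp: window_Suc_append u_def)
      then show False
        using inj[of j 0] inj[of j i] j i \<open>0 < N\<close> by auto
    qed
  next
    fix j
    assume "j + Suc m < N + m"
    then show "window w (Suc m) j \<noteq> window w (Suc m) (N + m - Suc m)"
      using inj[of j "N - 1"] by auto
  qed
  then have "w (N + m) = w m"
    using em ui by (simp add: N_def)
  then show ?thesis
    using ends by (simp add: window_Suc_append N_def u_def)
qed

section \<open>The circuit once the first generated digit has closed it, and the permutation it
  leaves\<close>

locale debruijn_cycle =
  fixes w :: "nat \<Rightarrow> bool" and m :: nat
  assumes windows: "bij_betw (window w (Suc m)) {..<2 ^ Suc m} {v. length v = Suc m}"
    and closes: "window w (Suc m) (2 ^ Suc m) = window w (Suc m) 0"
begin

abbreviation N :: nat where "N \<equiv> 2 ^ Suc m"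
abbreviation V :: "bool list set" where "V \<equiv> {v. length v = Suc m}"
abbreviation win :: "nat \<Rightarrow> bool list" where "win \<equiv> window w (Suc m)"

text \<open>Each vertex occupies one position on the circuit; this is the digit by which the circuit
  leaves it.\<close>

definition digit :: "bool list \<Rightarrow> bool" where
  "digit v = w (inv_into {..<N} win v + Suc m)"

text \<open>The successor of a vertex along the edge that the circuit leaves out; the identity off the
  vertex set makes it a permutation.\<close>

definition other :: "bool list \<Rightarrow> bool list" where
  "other v = (if length v = Suc m then tl v @ [\<not> digit v] else v)"

abbreviation period :: nat where "period \<equiv> funpow_dist1 other (win 0) (win 0)"

lemma win_inj: "win i = win j \<longleftrightarrow> i = j" if "i < N" "j < N"
  using windows that by (auto simp: bij_betw_def inj_on_def)

lemma win_surj: "v \<in> V \<Longrightarrow> \<exists>i<N. win i = v"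
  using bij_betw_imp_surj_on[OF windows] by (metis (no_types, lifting) imageE lessThan_iff)

lemma digit_win: "i < N \<Longrightarrow> digit (win i) = w (i + Suc m)"
  unfolding digit_def using windows by (subst inv_into_f_f) (auto simp: bij_betw_def)

lemma win_Suc: "i < N \<Longrightarrow> win (Suc i) = tl (win i) @ [digit (win i)]"
  by (simp only: window_Suc_tl digit_win)

text \<open>By \<open>closes\<close>, passing from \<open>i\<close> to \<open>Suc i\<close> is a
  cyclic shift of the \<open>N\<close> positions.\<close>

lemma win_Suc_inj:
  assumes "win (Suc i) = win (Suc j)" "i < N" "j < N"
  shows "i = j"
proof -
  have "win (Suc k) = win (Suc k mod N)" if "k < N" for k
    using that closes by (cases "Suc k = N") auto
  then have "Suc i mod N = Suc j mod N"
    using assms win_inj[of "Suc i mod N" "Suc j mod N"] by simp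
  then show ?thesis
    using assms(2,3) by (auto simp: mod_Suc split: if_splits)
qed

lemma win_Suc_neq: "i < N \<Longrightarrow> win (Suc i) \<noteq> win i"
  using win_inj[of "Suc i" i] win_inj[of 0 i] closes by (cases "Suc i = N") auto

lemma win_Suc_neq_other: "i < N \<Longrightarrow> win (Suc i) \<noteq> other (win i)"
  by (simp add: win_Suc other_def)

text \<open>Complementing last digits turns equal images under \<open>other\<close> into equal
  circuit successors, and the circuit enters each vertex only once.\<close>

lemma other_permutes: "other permutes V"
proof (rule bij_imp_permutes)
  have "inj_on other V"
  proof
    fix u v
    assume "u \<in> V" "v \<in> V" and eq: "other u = other v"
    then obtain i j where ij: "i < N" "win i = u" "j < N" "win j = v"
      using win_surj by blast
    from eq have "tl (win i) @ [digit (win i)] = tl (win j) @ [digit (win j)]"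
      using ij by (auto simp: other_def)
    then show "u = v"
      using ij win_Suc_inj[of i j] by (simp add: win_Suc)
  qed
  moreover have "other ` V \<subseteq> V"
    by (auto simp: other_def)
  ultimately show "bij_betw other V V"
    using endo_inj_surj[OF finite_binary_words] by (simp add: bij_betw_def)
qed (simp add: other_def)

lemma permutation_other: "permutation other"
  using other_permutes finite_binary_words permutation_permutes by blast

text \<open>The circuit visits at least two vertices, so it cannot use the loop at a constant
  word.\<close>

lemma digit_replicate: "digit (replicate (Suc m) x) = (\<not> x)"
proof -
  obtain i where i: "i < N" "win i = replicate (Suc m) x"
    using win_surj[of "replicate (Suc m) x"] by auto
  then have "tl (replicate (Suc m) x) @ [digit (replicate (Suc m) x)] \<noteq> replicate (Suc m) x"
    using win_Suc_neq[of i] win_Suc[of i] by simp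
  moreover have "tl (replicate (Suc m) x) @ [x] = replicate (Suc m) x"
    by (simp add: replicate_append_same)
  ultimately have "digit (replicate (Suc m) x) \<noteq> x"
    by (auto simp only:)
  then show ?thesis
    by blast
qed

lemma other_replicate: "other (replicate (Suc m) x) = replicate (Suc m) x"
  using digit_replicate[of x] by (simp add: other_def replicate_append_same)

section \<open>The path traced by the generated digits\<close>

lemma other_pow_neq:
  assumes "i < period" "j < period" "i \<noteq> j"
  shows "(other ^^ i) (win 0) \<noteq> (other ^^ j) (win 0)"
  by (rule funpow_neq_less_funpow_dist1[OF permutation_self_in_orbit[OF permutation_other] assms])

text \<open>Strong induction, since each step compares the current vertex with all earlier ones on
  the loop. Before \<open>period\<close> they differ, so the latest earlier visit to the current
  vertex is the one made by the circuit, and the rule takes the opposite exit.\<close>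

lemma em_path:
  assumes b: "enat (Suc m) \<le> b"
    and em: "\<And>k. k < period \<Longrightarrow> w (N + k + Suc m) = em_next b (map w [0..<N + k + Suc m])"
  shows "j \<le> period \<Longrightarrow> win (N + j) = (other ^^ j) (win 0)"
proof (induction j rule: less_induct)
  case (less j)
  show ?case
  proof (cases j)
    case 0
    then show ?thesis
      using closes by simp
  next
    case (Suc k)
    then have k: "k < period"
      using less.prems by simp
    have IH: "win (N + i) = (other ^^ i) (win 0)" if "i \<le> k" for i
      using less.IH[of i] less.prems that Suc by simp
    have fresh: "win (N + i) \<noteq> win (N + l)" if "i < l" "l \<le> k" for i l
      using that k IH[of i] IH[of l] other_pow_neq[of i l] by simp
    obtain i where i: "i < N" "win i = win (N + k)"
      using win_surj[of "win (N + k)"] by auto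
    have "em_next b (map w [0..<N + k + Suc m]) = (\<not> w (i + Suc m))"
    proof (rule em_next_eq[OF _ b])
      show "0 < Suc m" "i + Suc m < N + k + Suc m" "win i = win (N + k + Suc m - Suc m)"
        using i by simp_all
    next
      fix l
      assume l: "i < l" "l + Suc m < N + k + Suc m"
      show "win l \<noteq> win (N + k + Suc m - Suc m)"
      proof (cases "l < N")
        case True
        then show ?thesis
          using l i win_inj[of l i] by simp
      next
        case False
        then show ?thesis
          using l fresh[of "l - N" k] by simp
      qed
    next
      fix l
      assume "l + Suc (Suc m) < N + k + Suc m"
      then have l: "Suc l < N + k"
        by simp
      \<comment> \<open>A window of length \<open>m + 2\<close> is an edge, so the claim is that the
        edge just traversed is new. For \<open>k = 0\<close> it is the closing edge of the circuit.
        Otherwise it is an \<open>other\<close> edge, which the circuit never uses, and no earlier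
        edge of the loop starts at the same vertex.\<close>
      have "win l \<noteq> win (N + k - 1) \<or> win (Suc l) \<noteq> win (N + k)"
      proof (cases k)
        case 0
        with l have "l < N - 1"
          by arith
        then show ?thesis
          using 0 win_inj[of l "N - 1"] by simp
      next
        case (Suc k')
        show ?thesis
        proof (cases "l < N")
          case True
          have "win (N + k) = other (win (N + k'))"
            using IH[of k] IH[of k'] Suc by simp
          then show ?thesis
            using win_Suc_neq_other[OF True] Suc by auto
        next
          case False
          then show ?thesis
            using fresh[of "l - N" k'] l Suc by simp
        qed
      qed
      moreover have "N + k + Suc m - Suc (Suc m) = N + k - 1" "Suc (N + k - 1) = N + k"
        by simp_all
      ultimately show "window w (Suc (Suc m)) l \<noteq> window w (Suc (Suc m)) (N + k + Suc m - Suc (Suc m))"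
        using window_Suc[of w "Suc m"] window_Suc_append[of w "Suc m"]
        by (metis butlast_snoc list.inject)
    qed
    then have "w (N + k + Suc m) = (\<not> digit (win (N + k)))"
      using em[OF k] i digit_win[of i] by simp
    then have "win (Suc (N + k)) = other (win (N + k))"
      by (simp add: window_Suc_tl other_def)
    then show ?thesis
      using IH[of k] Suc by simp
  qed
qed

text \<open>Two arcs of the de Bruijn graph leave each vertex \<open>v\<close>; the circuit uses the
  one with last digit \<open>digit v\<close>, and the remaining one leads to
  \<open>other v\<close>.\<close>

lemma circuit_complement_eq:
  "circuit_complement (Suc m) (map w [0..<N + m]) = perm_graph other V"
proof -
  let ?Z = "map w [0..<N + m]"
  obtain k where k: "N = Suc k"
    by (metis not0_implies_Suc power_not_zero zero_neq_numeral)
  have pv: "path_verts (Suc m) ?Z = map win [0..<Suc k]"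
    by (auto simp: path_verts_def k take_drop_eq_window simp del: power_Suc upt_Suc)
  have "hd (map win [0..<Suc k]) = win 0"
    by (simp add: hd_map del: upt_Suc)
  then have "circuit_arcs (Suc m) ?Z
      = insert (win k, win 0) (set (map (\<lambda>j. (win j, win (Suc j))) [0..<k]))"
    unfolding circuit_arcs_def induced_path_def pv vwalk_arcs_map_upt by simp
  \<comment> \<open>By \<open>closes\<close>, the inserted closing arc is the arc at position
    \<open>N - 1\<close>.\<close>
  also have "\<dots> = (\<lambda>i. (win i, win (Suc i))) ` {..<N}"
    using closes unfolding k by (auto simp: less_Suc_eq)
  also have "\<dots> = (\<lambda>v. (v, tl v @ [digit v])) ` win ` {..<N}"
    unfolding image_image by (rule image_cong) (simp_all only: win_Suc lessThan_iff)
  also have "win ` {..<N} = V"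
    using windows by (simp only: bij_betw_def)
  finally have circ: "circuit_arcs (Suc m) ?Z = (\<lambda>v. (v, tl v @ [digit v])) ` V" .
  have arcs: "parcs (debruijn_graph (Suc m)) = {(v, tl v @ [y]) | v y. v \<in> V}"
    unfolding debruijn_graph_def
    by (auto simp: length_Suc_conv)
  have "parcs (debruijn_graph (Suc m)) - circuit_arcs (Suc m) ?Z = (\<lambda>v. (v, other v)) ` V"
    unfolding arcs circ by (auto simp: other_def image_iff)
  then show ?thesis
    by (simp add: circuit_complement_def perm_graph_def debruijn_graph_def)
qed

section \<open>The length of the cycle and the words of length \<open>m + 2\<close>\<close>

lemma period_eq:
  assumes "orbit other (win 0) = V - {replicate (Suc m) False, replicate (Suc m) True}"
  shows "N = Suc (Suc period)"
proof -
  have self: "win 0 \<in> orbit other (win 0)"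
    using permutation_other by (rule permutation_self_in_orbit)
  have "card (orbit other (win 0)) = period"
    unfolding orbit_conv_funpow_dist1[OF self] by (simp only: card_image[OF inj_on_funpow_dist1[OF self]] card_atLeastLessThan diff_zero)
  moreover have "card (V - {replicate (Suc m) False, replicate (Suc m) True}) = N - 2"
    by (subst card_Diff_subset) (simp_all add: card_binary_words del: power_Suc)
  ultimately have "N - 2 = Suc (funpow_dist other (other (win 0)) (win 0))"
    using assms by simp
  then show ?thesis
    by arith
qed

text \<open>A word \<open>v @ [y]\<close> is an edge out of \<open>v\<close>. If
  \<open>y = digit v\<close>, it is read once on the circuit and never on the loop; otherwise it is
  read once on the loop, unless \<open>v\<close> is constant, when the word is constant too. Both
  constant words are thus omitted.\<close>

lemma depleted:
  assumes path: "\<And>j. j \<le> period \<Longrightarrow> win (N + j) = (other ^^ j) (win 0)"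
    and orb: "orbit other (win 0) = V - {replicate (Suc m) False, replicate (Suc m) True}"
  shows "depleted_debruijn_string (Suc (Suc m)) (map w [0..<N + m + (N - 1)])"
proof -
  let ?X = "map w [0..<N + m + (N - 1)]"
  let ?C = "{replicate (Suc m) False, replicate (Suc m) True}"
  let ?D = "{replicate (Suc (Suc m)) False, replicate (Suc (Suc m)) True}"
  have p: "N = Suc (Suc period)"
    using orb by (rule period_eq)
  have occ: "{i. occurs_at (v @ [y]) i ?X}
      = {i. i < N + period \<and> win i = v \<and> w (i + Suc m) = y}" if "v \<in> V" for v y
  proof -
    \<comment> \<open>Of the \<open>N - 1\<close> digits after the seed, one closes the circuit and
      the other \<open>period\<close> go round the loop.\<close>
    have "i + Suc (Suc m) \<le> N + m + (N - 1) \<longleftrightarrow> i < N + period" for i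
      using p by arith
    then show ?thesis
      using that by (simp add: occurs_at_map_upt window_Suc_append[of w "Suc m"] del: power_Suc)
  qed
  have w_other: "w (N + j + Suc m) = (\<not> digit (win (N + j)))" if "j < period" for j
  proof -
    have "win (Suc (N + j)) = other (win (N + j))"
      using path[of j] path[of "Suc j"] that by simp
    then show ?thesis
      by (simp add: window_Suc_tl other_def)
  qed
  have D_iff: "v @ [y] \<in> ?D \<longleftrightarrow> v \<in> ?C \<and> y = (\<not> digit v)" if "v \<in> V" for v y
  proof -
    have "replicate (Suc (Suc m)) x = replicate (Suc m) x @ [x]" for x :: bool
      by (simp add: replicate_append_same)
    then show ?thesis
      using digit_replicate[of False] digit_replicate[of True]
      by (auto simp only: insert_iff empty_iff append1_eq_conv)
  qed
  have "card {i. occurs_at (v @ [y]) i ?X} = (if v @ [y] \<in> ?D then 0 else 1)" if v: "v \<in> V" for v y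
  proof -
    obtain i where i: "i < N" "win i = v"
      using win_surj[OF v] by blast
    show ?thesis
    proof (cases "y = digit v")
      case True
      have below: "j < N" if j: "j < N + period" "win j = v" "w (j + Suc m) = y" for j
      proof (rule ccontr)
        assume "\<not> j < N"
        then obtain k where k: "j = N + k"
          by (metis le_add_diff_inverse not_less)
        then have "k < period"
          using j by simp
        then show False
          using w_other[of k] j True k by simp
      qed
      have "{i. i < N + period \<and> win i = v \<and> w (i + Suc m) = y} = {i}"
      proof (intro set_eqI iffI)
        fix j
        assume j: "j \<in> {i. i < N + period \<and> win i = v \<and> w (i + Suc m) = y}"
        then have "j < N"
          using below[of j] by blast
        then show "j \<in> {i}"
          using j i win_inj[of j i] by simp
      next
        fix j
        assume "j \<in> {i}"
        then show "j \<in> {i. i < N + period \<and> win i = v \<and> w (i + Suc m) = y}"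
          using i True digit_win[of i] by simp
      qed
      then show ?thesis
        using occ[OF v] D_iff[OF v] True by simp
    next
      case False
      have eq: "{i. i < N + period \<and> win i = v \<and> w (i + Suc m) = y}
          = (\<lambda>j. N + j) ` {j. j < period \<and> (other ^^ j) (win 0) = v}"
      proof (intro set_eqI iffI)
        fix l
        assume l: "l \<in> {i. i < N + period \<and> win i = v \<and> w (i + Suc m) = y}"
        then have "N \<le> l"
          using digit_win[of l] False by (cases "l < N") auto
        then show "l \<in> (\<lambda>j. N + j) ` {j. j < period \<and> (other ^^ j) (win 0) = v}"
          using l path[of "l - N"] by (intro image_eqI[of _ _ "l - N"]) auto
      next
        fix l
        assume "l \<in> (\<lambda>j. N + j) ` {j. j < period \<and> (other ^^ j) (win 0) = v}"
        then show "l \<in> {i. i < N + period \<and> win i = v \<and> w (i + Suc m) = y}"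
          using path w_other False by auto
      qed
      have self: "win 0 \<in> orbit other (win 0)"
        using permutation_other by (rule permutation_self_in_orbit)
      have orb': "v \<notin> ?C \<longleftrightarrow> (\<exists>j<period. (other ^^ j) (win 0) = v)"
      proof -
        have "v \<in> orbit other (win 0) \<longleftrightarrow> (\<exists>j\<in>{0..<period}. v = (other ^^ j) (win 0))"
          unfolding orbit_conv_funpow_dist1[OF self] by (rule image_iff)
        moreover have "v \<in> orbit other (win 0) \<longleftrightarrow> v \<notin> ?C"
          using v unfolding orb by blast
        ultimately show ?thesis
          by (metis atLeastLessThan_iff zero_le)
      qed
      have "card {j. j < period \<and> (other ^^ j) (win 0) = v} = (if v \<in> ?C then 0 else 1)"
      proof (cases "v \<in> ?C")
        case True
        then have "{j. j < period \<and> (other ^^ j) (win 0) = v} = {}"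
          using orb' by blast
        with True show ?thesis
          by simp
      next
        case False
        then obtain j where j: "j < period" "(other ^^ j) (win 0) = v"
          using orb' by blast
        then have "{j. j < period \<and> (other ^^ j) (win 0) = v} = {j}"
          using other_pow_neq by blast
        with False show ?thesis
          by simp
      qed
      moreover have "card ((\<lambda>j. N + j) ` {j. j < period \<and> (other ^^ j) (win 0) = v})
          = card {j. j < period \<and> (other ^^ j) (win 0) = v}"
        by (rule card_image) simp
      moreover have "y = (\<not> digit v)"
        using False by blast
      ultimately show ?thesis
        unfolding occ[OF v] eq D_iff[OF v] by (simp only: simp_thms)
    qed
  qed
  then have "card {i. occurs_at u i ?X} = (if u \<in> ?D then 0 else 1)" if "length u = Suc (Suc m)" for u
    using that by (cases u rule: rev_cases) auto
  then show ?thesis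
    unfolding depleted_debruijn_string_def by (intro exI[of _ ?D]) auto
qed

end

section \<open>The message loop\<close>

theorem theorem4p1:
  fixes n :: nat and Z \<tau> Y :: "bool list"
  assumes "n \<ge> 1"
    and "double_helix n Z"
    and "\<tau> = take n Z"
    and "\<tau> \<noteq> replicate n False" and "\<tau> \<noteq> replicate n True"
    and "Y = initial_string (2 ^ n - 1) (EM_n n Z) \<or> Y = initial_string (2 ^ n - 1) (EM Z)"
  shows "(\<exists>u. pre_digraph.euler_trail (message_loop n Z) u (induced_path n (butlast \<tau> @ Y)) u) \<and>
         depleted_debruijn_string (n + 1) (Z @ Y)"
proof -
  obtain m where n: "n = Suc m"
    using assms(1) by (cases n) auto
  define N where "N = (2 ^ Suc m :: nat)"
  \<comment> \<open>\<open>EM_n\<close> and \<open>EM\<close> differ only in the bound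
    \<open>b\<close>; the argument needs just \<open>enat n \<le> b\<close>.\<close>
  obtain b where b: "enat n \<le> b" and Y: "Y = initial_string (N - 1) (em_seq b Z)"
    using assms(6) that[of "enat n"] that[of \<infinity>] by (auto simp: EM_n_def EM_def N_def n)
  define w where "w i = (if i < length Z then Z ! i else em_seq b Z (i - length Z))" for i
  have db: "debruijn_string (Suc m) Z"
    using assms(2) by (simp add: double_helix_def n)
  then have len: "length Z = N + m"
    by (simp add: debruijn_string_def N_def)
  have word: "em_word b Z k = map w [0..<N + m + k]" for k
    unfolding w_def[abs_def] len[symmetric] by (rule em_word_eq_map)
  have Zw: "Z = map w [0..<N + m]"
    using word[of 0] by simp
  have em: "w (N + m + k) = em_next b (map w [0..<N + m + k])" for k
    by (simp only: word[symmetric]) (simp add: w_def len em_seq_def)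
  have Yw: "Y = map (\<lambda>k. w (N + m + k)) [0..<N - 1]"
    unfolding Y initial_string_def by (simp add: w_def len)
  have \<tau>: "\<tau> = window w (Suc m) 0"
    using take_drop_eq_window[of 0 "Suc m" "N + m" w] assms(3) n Zw by (simp add: N_def)
  \<comment> \<open>For \<open>n = 1\<close> every vertex is a constant word, which the hypotheses
    on \<open>\<tau>\<close> exclude. The closing step needs a tail of positive length
    \<open>m\<close>.\<close>
  have "0 < m"
  proof (rule ccontr)
    assume "\<not> 0 < m"
    then obtain x where "\<tau> = [x]"
      using \<tau> by (simp add: window_def)
    then show False
      using assms(4,5) n \<open>\<not> 0 < m\<close> by (cases x) auto
  qed
  have bij: "bij_betw (window w (Suc m)) {..<2 ^ Suc m} {v. length v = Suc m}"
    using db Zw by (intro debruijn_windows) (simp add: N_def)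
  interpret debruijn_cycle w m
  proof
    show "window w (Suc m) (2 ^ Suc m) = window w (Suc m) 0"
      using em[of 0] b \<open>0 < m\<close> unfolding N_def n
      by (intro em_closes_debruijn[OF bij]) (auto elim: order_trans[rotated])
  qed (rule bij)
  have G: "circuit_complement n Z = perm_graph other V"
    using circuit_complement_eq Zw n by (simp add: N_def)
  have path: "win (2 ^ Suc m + j) = (other ^^ j) (win 0)" if "j \<le> period" for j
  proof (rule em_path[OF _ _ that])
    show "enat (Suc m) \<le> b"
      using b n by simp
    show "w (2 ^ Suc m + k + Suc m) = em_next b (map w [0..<2 ^ Suc m + k + Suc m])" for k
      using em[of "Suc k"] by (simp add: N_def add_ac)
  qed
  have K: "card (components (perm_graph other V)) = 3"
    using assms(2) G by (simp add: double_helix_def)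
  have \<tau>': "win 0 \<noteq> replicate (Suc m) False" "win 0 \<noteq> replicate (Suc m) True"
    using assms(4,5) \<tau> n by simp_all
  note three = three_components[OF other_permutes finite_binary_words K _ _ other_replicate other_replicate _ _ \<tau>']
  have orb: "orbit other (win 0) = V - {replicate (Suc m) False, replicate (Suc m) True}"
    by (rule three(1)) simp_all
  have loop: "message_loop n Z = perm_graph other (orbit other (win 0))"
    unfolding message_loop_def G unfolding n by (rule three(2)) simp_all
  have p: "N = Suc (Suc period)"
    using period_eq[OF orb] by (simp add: N_def)
  \<comment> \<open>After the circuit closes, position \<open>N\<close> again reads
    \<open>\<tau>\<close>, whose last digit is the first digit of \<open>Y\<close>; so
    \<open>butlast \<tau> @ Y\<close> is the part of \<open>w\<close> that starts at
    \<open>N\<close>.\<close>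
  have "butlast \<tau> = window w m N"
    using closes \<tau> by (simp add: N_def window_Suc_append)
  then have word_eq: "butlast \<tau> @ Y = window w (m + (N - 1)) N"
    unfolding Yw window_def
    by (intro nth_equalityI) (auto simp: nth_append)
  have verts: "take (Suc m) (drop j (window w (m + (N - 1)) N)) = (other ^^ j) (win 0)"
    if "j \<le> period" for j
  proof -
    have "j + Suc m \<le> m + (N - 1)"
      using that p by simp
    then show ?thesis
      using path[OF that] by (simp only: take_drop_window N_def)
  qed
  have len_eq: "length (window w (m + (N - 1)) N) - Suc m = period"
    using p by simp
  have "path_verts n (butlast \<tau> @ Y) = map (\<lambda>j. (other ^^ j) (win 0)) [0..<Suc period]"
    unfolding path_verts_def n word_eq len_eq 
    by (intro map_cong refl verts) (simp only: set_upt atLeastLessThan_iff less_Suc_eq_le)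
  then have "pre_digraph.euler_trail (message_loop n Z) (win 0) (induced_path n (butlast \<tau> @ Y)) (win 0)"
    unfolding loop induced_path_def using euler_trail_orbit[OF permutation_other] by (simp only:)
  moreover have "depleted_debruijn_string (n + 1) (Z @ Y)"
  proof -
    have "Z @ Y = map w [0..<N + m + (N - 1)]"
      unfolding Yw by (subst Zw, intro nth_equalityI) (auto simp: nth_append)
    then show ?thesis
      using depleted[OF path orb] by (simp add: N_def n)
  qed
  ultimately show ?thesis
    by blast
qed

end
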